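(* Consider the (possibly nonconvex) mixed-integer nonlinear program (MINLP) $\min_{x\in X,\,y\in Y} f(x,y)$ subject to $g(x,y)\le 0$, $h(x,y)=0$, and suppose that: (1) $Y=\bar Y\cap\mathbb{Z}^{n_y}$, where $X\subset\mathbb{R}^{n_x}$ and $\bar Y\subset\mathbb{R}^{n_y}$ are closed convex polyhedral sets; $f:\mathbb{R}^{n_x}\times\mathbb{R}^{n_y}\to\mathbb{R}$, $g:\mathbb{R}^{n_x}\times\mathbb{R}^{n_y}\to\mathbb{R}^{n_g}$, $h:\mathbb{R}^{n_x}\times\mathbb{R}^{n_y}\to\mathbb{R}^{n_h}$ are at least twice continuously differentiable; and $Y$ is finite; (2) for all $y\in Y$, the Mangasarian-Fromovitz constraint qualification holds at the solution $x^\star$ of the problem $\mathrm{NLP}(y)$: $\min_{x\in X} f(x,y)$ s.t. $g(x,y)\le0$, $h(x,y)=0$; (3) the set $\bar{\mathcal F}=\{y\in\bar Y:\exists x\in X,\ g(x,y)\le0,\ h(x,y)=0\}$ is convex. Then the enhanced S-B-MIQP algorithm described in the context (with gradient correction and amplification for the Benders cuts, and correction of the infeasibility cuts) terminates in a finite number of iterations and returns either a feasible solution of the MINLP or a certificate of infeasibility of the MINLP (i.e. it terminates with $\mathrm{LB}=\mathrm{UB}=+\infty$, and the MINLP is infeasible).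
   Context: Notation. For a vector-valued $\phi$, $\nabla\phi$ is the transpose of the Jacobian. $\phi_{\mathrm L}(x,y;\bar x,\bar y)=\phi(\bar x,\bar y)+\nabla\phi(\bar x,\bar y)^\top\binom{x-\bar x}{y-\bar y}$ is the linearization of $\phi$ at $(\bar x,\bar y)$. $W$ is a fixed symmetric positive definite matrix and $\|v\|_W^2=v^\top Wv$. Value function. $J(y)=\min_{x\in X}\{f(x,y): g(x,y)\le0,\ h(x,y)=0\}$, the optimal value of $\mathrm{NLP}(y)$, with $J(y)=+\infty$ if infeasible. If $x^\star$ is the optimal solution of $\mathrm{NLP}(\tilde y)$, then $\nabla J(\tilde y):=\nabla_y f(x^\star,\tilde y)+\nabla_y g(x^\star,\tilde y)\lambda+\nabla_y h(x^\star,\tilde y)\mu$, where $(\lambda,\mu)$ are KKT multipliers, i.e. $\nabla_x f(x^\star,\tilde y)+\nabla_x g(x^\star,\tilde y)\lambda+\nabla_x h(x^\star,\tilde y)\mu=0$, $\lambda\ge0$, $\lambda_i g_i(x^\star,\tilde y)=0$ for all $i$. Feasibility problem $\mathrm{FNLP}(\hat y,y_b)$: $\min_{x\in X,\,y\in\bar Y}\|y-\hat y\|_2^2$ s.t. $g(x,y)\le0$, $h(x,y)=0$ and, only if a feasible incumbent $y_b$ is available, $\|y_b-y\|_2^2\le\|y_b-\hat y\|_2^2$. The $y$-component of its solution is denoted $\bar y$. Bookkeeping. $y_k\in Y$ is the integer point processed at iteration $k$. $\mathbb{T}_k$ (resp. $\mathbb{S}_k$) is the set of indices $i\le k$ for which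 $\mathrm{NLP}(y_i)$ is feasible (resp. infeasible). For $i\in\mathbb{T}_k$, $x_i$ is the solution of $\mathrm{NLP}(y_i)$; for $i\in\mathbb{S}_k$, $(x_i,\bar y_i)$ is the solution of the feasibility problem. The best index is $b(k)\in\arg\min_{i\in\mathbb{T}_k}J(y_i)$ if $\mathbb{T}_k\ne\emptyset$, and $b(k)\in\arg\min_{i\in\mathbb{S}_k}\|\bar y_i-y_i\|_2^2$ otherwise; ties are broken by the smallest index. Let $\alpha\in[0,1)$ be a fixed parameter and $\bar J_k=\alpha J(y_{b(k)})+(1-\alpha)\mathrm{LB}$ with the current lower bound $\mathrm{LB}$. Corrections at iteration $k$. Gradient correction: for $i\in\mathbb{T}_k$, $g^{\mathrm{corr}}_{(i,k)}$ is the minimizer of $\frac12\|g-\nabla J(y_i)\|_W^2$ over all $g$ with $J(y_i)+g^\top(y_{b(k)}-y_i)\le J(y_{b(k)})$. Amplification: with a fixed constant $\rho\ge1$, the gradient used in the cut is $\tilde g_{(i,k)}=\rho\, g^{\mathrm{corr}}_{(i,k)}$ if the gradient had to be corrected (i.e. $J(y_i)+\nabla J(y_i)^\top(y_{b(k)}-y_i)>J(y_{b(k)})$), and $\tilde g_{(i,k)}=\nabla J(y_i)$ otherwise. Infeasibility-cut correction: for $i\in\mathbb{S}_k$, if $\mathbb{T}_k\neq\emptyset$, $\tilde n_{(i,k)}$ is the minimizer of $\frac12\|n-(y_i-\bar y_i)\|_W^2$ over all $n$ with $n^\top(y_{b(k)}-\bar y_i)\le0$; if $\mathbb{T}_k=\emptyset$,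 $\tilde n_{(i,k)}=y_i-\bar y_i$. Master problem BR-MIQP at iteration $k$ (with $b=b(k)$ and $B_b$ a symmetric positive semidefinite matrix approximating the Hessian of the Lagrangian): minimize over $x\in X$, $y\in Y$ the function $f_{\mathrm L}(x,y;x_b,y_b)+\frac12\binom{x-x_b}{y-y_b}^\top B_b\binom{x-x_b}{y-y_b}$ subject to $g_{\mathrm L}(x,y;x_b,y_b)\le0$, $h_{\mathrm L}(x,y;x_b,y_b)=0$, $J(y_i)+\tilde g_{(i,k)}^\top(y-y_i)\le\bar J_k$ for $i\in\mathbb{T}_k$, and $\tilde n_{(i,k)}^\top(y-\bar y_i)\le0$ for $i\in\mathbb{S}_k$. Master problem LB-MILP at iteration $k$: minimize $\eta$ over $\eta\in\mathbb{R}$, $x\in X$, $y\in Y$ subject to (only if $b\in\mathbb{T}_k$) $\eta\ge f_{\mathrm L}(x,y;x_b,y_b)$, $0\ge g_{\mathrm L}(x,y;x_b,y_b)$, $0=h_{\mathrm L}(x,y;x_b,y_b)$; $\eta\ge J(y_i)+\tilde g_{(i,k)}^\top(y-y_i)$ for $i\in\mathbb{T}_k\setminus\{b\}$; and $0\ge\tilde n_{(i,k)}^\top(y-\bar y_i)$ for $i\in\mathbb{S}_k$. Its optimal value is $V_{\mathrm{MILP}}$. Enhanced S-B-MIQP algorithm. Initialize with $y_0\in Y$, $k=0$, $\mathbb{S}_{-1}=\mathbb{T}_{-1}=\emptyset$, $\mathrm{UB}=+\infty$, $\mathrm{LB}=\min_{y\in\bar Y}J(y)$ (equal to $+\infty$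 if the continuous relaxation is infeasible). While $\mathrm{LB}<\mathrm{UB}$: (i) Solve $\mathrm{NLP}(y_k)$. If feasible, store $(k,x_k,y_k,J(y_k),\nabla J(y_k))$, set $\mathbb{T}_k=\mathbb{T}_{k-1}\cup\{k\}$, $\mathbb{S}_k=\mathbb{S}_{k-1}$, and if $J(y_k)<\mathrm{UB}$ set $\mathrm{UB}=J(y_k)$. If infeasible, solve $\mathrm{FNLP}(y_k,y_b)$ with the current incumbent $y_b$ (if any), store $\bar y_k$, set $\mathbb{S}_k=\mathbb{S}_{k-1}\cup\{k\}$, $\mathbb{T}_k=\mathbb{T}_{k-1}$. (ii) Compute $b(k)$ and the corrected data $\tilde g_{(i,k)}$, $\tilde n_{(i,k)}$. (iii) If $k-b(k)\le1$, solve BR-MIQP and, if feasible, let $\tilde y$ be the $y$-component of its solution. (iv) If $k-b(k)>1$ or BR-MIQP is infeasible, solve LB-MILP. If it is infeasible, set $\mathrm{LB}=+\infty$. Otherwise let $\tilde y$ be the $y$-component of its solution, and if $V_{\mathrm{MILP}}>\mathrm{LB}$ set $\mathrm{LB}=V_{\mathrm{MILP}}$. (v) Set $y_{k+1}=\tilde y$, $k\leftarrow k+1$. On termination, the algorithm returns the incumbent $(x_b,y_b)$, i.e. the best feasible point found, with objective $\mathrm{UB}$, if one exists; otherwise it terminates with $\mathrm{LB}=\mathrm{UB}=+\infty$, which is the certificate of infeasibility. Conventions. All subproblems are solved exactly (to global optimality): each feasible subproblem has an optimal solution, which is returned, and, for every feasible $\mathrm{NLP}(y_k)$ with optimal solution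 $x_k$, KKT multipliers $(\lambda,\mu)$ satisfying $\nabla_x f(x_k,y_k)+\nabla_x g(x_k,y_k)\lambda+\nabla_x h(x_k,y_k)\mu=0$, $\lambda\ge0$, $\lambda_i g_i(x_k,y_k)=0$ for all $i$, are available. The only exception is LB-MILP with $\mathbb{T}_k=\emptyset$, which, if feasible, is unbounded in $\eta$; then any feasible $y$ is returned and $V_{\mathrm{MILP}}=-\infty$. *)

theory Defs
  imports "HOL-Analysis.Analysis"
begin

definition twice_cont_diff :: "('a::real_normed_vector \<Rightarrow> real) \<Rightarrow> bool" where
  "twice_cont_diff F \<longleftrightarrow>
     (\<exists>(F1 :: 'a \<Rightarrow> 'a \<Rightarrow>\<^sub>L real) (F2 :: 'a \<Rightarrow> 'a \<Rightarrow>\<^sub>L ('a \<Rightarrow>\<^sub>L real)).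
        (\<forall>z. (F has_derivative blinfun_apply (F1 z)) (at z)) \<and>
        (\<forall>z. (F1 has_derivative blinfun_apply (F2 z)) (at z)) \<and>
        continuous_on UNIV F2)"

definition grad :: "('a::real_inner \<Rightarrow> real) \<Rightarrow> 'a \<Rightarrow> 'a" where
  "grad F z = (THE D. GDERIV F z :> D)"

definition grad_x :: "('a::real_inner \<times> 'b::real_inner \<Rightarrow> real) \<Rightarrow> 'a \<Rightarrow> 'b \<Rightarrow> 'a" where
  "grad_x F x y = fst (grad F (x, y))"

definition grad_y :: "('a::real_inner \<times> 'b::real_inner \<Rightarrow> real) \<Rightarrow> 'a \<Rightarrow> 'b \<Rightarrow> 'b" where
  "grad_y F x y = snd (grad F (x, y))"

definition linearization :: "('a::real_inner \<Rightarrow> real) \<Rightarrow> 'a \<Rightarrow> 'a \<Rightarrow> real" where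
  "linearization F z0 z = F z0 + grad F z0 \<bullet> (z - z0)"

definition symmetric_matrix :: "real^'n^'n \<Rightarrow> bool" where
  "symmetric_matrix A \<longleftrightarrow> transpose A = A"

definition quad_form :: "real^'n^'n \<Rightarrow> real^'n \<Rightarrow> real" where
  "quad_form A v = v \<bullet> (A *v v)"

definition pos_def :: "real^'n^'n \<Rightarrow> bool" where
  "pos_def A \<longleftrightarrow> symmetric_matrix A \<and> (\<forall>v. v \<noteq> 0 \<longrightarrow> quad_form A v > 0)"

definition pos_semidef :: "real^'n^'n \<Rightarrow> bool" where
  "pos_semidef A \<longleftrightarrow> symmetric_matrix A \<and> (\<forall>v. quad_form A v \<ge> 0)"

definition stack :: "real^'m \<Rightarrow> real^'n \<Rightarrow> real^('m + 'n)" where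
  "stack u v = (\<chi> i. case i of Inl a \<Rightarrow> u $ a | Inr b \<Rightarrow> v $ b)"

text \<open>The vector-valued constraint functions are given by their components
  \<open>ineq P i\<close> for \<open>i < n_ineq P\<close> and \<open>eqn P j\<close> for \<open>j < n_eqn P\<close>; in contrast to a
  type-indexed codomain this admits problems without inequalities or without equations.\<close>

record ('nx, 'ny) minlp =
  Xset :: "(real^'nx) set"
  Ybar :: "(real^'ny) set"
  obj :: "(real^'nx) \<times> (real^'ny) \<Rightarrow> real"
  n_ineq :: nat
  ineq :: "nat \<Rightarrow> (real^'nx) \<times> (real^'ny) \<Rightarrow> real"
  n_eqn :: nat
  eqn :: "nat \<Rightarrow> (real^'nx) \<times> (real^'ny) \<Rightarrow> real"

definition Yset :: "('nx::finite, 'ny::finite) minlp \<Rightarrow> (real^'ny) set" where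
  "Yset P = Ybar P \<inter> {y. \<forall>i. y $ i \<in> \<int>}"

definition nlp_set :: "('nx::finite, 'ny::finite) minlp \<Rightarrow> real^'ny \<Rightarrow> (real^'nx) set" where
  "nlp_set P y = {x \<in> Xset P. (\<forall>i<n_ineq P. ineq P i (x, y) \<le> 0) \<and>
                              (\<forall>j<n_eqn P. eqn P j (x, y) = 0)}"

definition minlp_set :: "('nx::finite, 'ny::finite) minlp \<Rightarrow> ((real^'nx) \<times> (real^'ny)) set" where
  "minlp_set P = {(x, y). y \<in> Yset P \<and> x \<in> nlp_set P y}"

definition relaxed_set :: "('nx::finite, 'ny::finite) minlp \<Rightarrow> ((real^'nx) \<times> (real^'ny)) set" where
  "relaxed_set P = {(x, y). y \<in> Ybar P \<and> x \<in> nlp_set P y}"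

definition Fbar :: "('nx::finite, 'ny::finite) minlp \<Rightarrow> (real^'ny) set" where
  "Fbar P = {y \<in> Ybar P. \<exists>x \<in> Xset P. (\<forall>i<n_ineq P. ineq P i (x, y) \<le> 0) \<and>
                                      (\<forall>j<n_eqn P. eqn P j (x, y) = 0)}"

definition nlp_sol :: "('nx::finite, 'ny::finite) minlp \<Rightarrow> real^'ny \<Rightarrow> real^'nx \<Rightarrow> bool" where
  "nlp_sol P y x \<longleftrightarrow> is_arg_min (\<lambda>x. obj P (x, y)) (\<lambda>x. x \<in> nlp_set P y) x"

text \<open>The infimum over the empty set is \<open>\<infinity>\<close> in \<^typ>\<open>ereal\<close>.\<close>

definition Jval :: "('nx::finite, 'ny::finite) minlp \<Rightarrow> real^'ny \<Rightarrow> ereal" where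
  "Jval P y = (INF x \<in> nlp_set P y. ereal (obj P (x, y)))"

definition KKT ::
  "('nx::finite, 'ny::finite) minlp \<Rightarrow> real^'ny \<Rightarrow> real^'nx \<Rightarrow> (nat \<Rightarrow> real) \<Rightarrow> (nat \<Rightarrow> real) \<Rightarrow> bool"
  where
  "KKT P y x lam mu \<longleftrightarrow>
     grad_x (obj P) x y + (\<Sum>i<n_ineq P. lam i *\<^sub>R grad_x (ineq P i) x y)
       + (\<Sum>j<n_eqn P. mu j *\<^sub>R grad_x (eqn P j) x y) = 0 \<and>
     (\<forall>i<n_ineq P. lam i \<ge> 0 \<and> lam i * ineq P i (x, y) = 0)"

definition gradJ ::
  "('nx::finite, 'ny::finite) minlp \<Rightarrow> real^'ny \<Rightarrow> real^'nx \<Rightarrow> (nat \<Rightarrow> real) \<Rightarrow> (nat \<Rightarrow> real) \<Rightarrow> real^'ny"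
  where
  "gradJ P y x lam mu =
     grad_y (obj P) x y + (\<Sum>i<n_ineq P. lam i *\<^sub>R grad_y (ineq P i) x y)
       + (\<Sum>j<n_eqn P. mu j *\<^sub>R grad_y (eqn P j) x y)"

text \<open>The Mangasarian--Fromovitz constraint qualification, like the KKT conditions above, concerns
  only \<open>ineq\<close> and \<open>eqn\<close>; the polyhedron \<open>Xset\<close> contributes no multipliers or directions.\<close>

definition MFCQ :: "('nx::finite, 'ny::finite) minlp \<Rightarrow> real^'ny \<Rightarrow> real^'nx \<Rightarrow> bool" where
  "MFCQ P y x \<longleftrightarrow>
     (\<forall>c. (\<Sum>j<n_eqn P. c j *\<^sub>R grad_x (eqn P j) x y) = 0 \<longrightarrow> (\<forall>j<n_eqn P. c j = 0)) \<and>
     (\<exists>d. (\<forall>j<n_eqn P. grad_x (eqn P j) x y \<bullet> d = 0) \<and>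
          (\<forall>i<n_ineq P. ineq P i (x, y) = 0 \<longrightarrow> grad_x (ineq P i) x y \<bullet> d < 0))"

definition fnlp_set ::
  "('nx::finite, 'ny::finite) minlp \<Rightarrow> real^'ny \<Rightarrow> (real^'ny) option \<Rightarrow> ((real^'nx) \<times> (real^'ny)) set"
  where
  "fnlp_set P yhat inc =
     {(x, y). y \<in> Ybar P \<and> x \<in> nlp_set P y \<and>
        (case inc of None \<Rightarrow> True | Some yb \<Rightarrow> (norm (yb - y))\<^sup>2 \<le> (norm (yb - yhat))\<^sup>2)}"

definition fnlp_sol ::
  "('nx::finite, 'ny::finite) minlp \<Rightarrow> real^'ny \<Rightarrow> (real^'ny) option \<Rightarrow> (real^'nx) \<times> (real^'ny) \<Rightarrow> bool"
  where
  "fnlp_sol P yhat inc z \<longleftrightarrow>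
     is_arg_min (\<lambda>(x, y). (norm (y - yhat))\<^sup>2) (\<lambda>z. z \<in> fnlp_set P yhat inc) z"

text \<open>The sequences are histories: at the head of iteration \<open>k = iter s\<close> the entries of \<open>yseq s\<close>
  up to \<open>k\<close> and those of the other sequences below \<open>k\<close> are meaningful.\<close>

record ('nx, 'ny) state =
  iter :: nat
  yseq :: "nat \<Rightarrow> real^'ny"
  xseq :: "nat \<Rightarrow> real^'nx"
  ybar_seq :: "nat \<Rightarrow> real^'ny"
  gradJ_seq :: "nat \<Rightarrow> real^'ny"
  Tset :: "nat set"
  Sset :: "nat set"
  UB :: ereal
  LB :: ereal

definition initial :: "('nx::finite, 'ny::finite) minlp \<Rightarrow> ('nx, 'ny) state \<Rightarrow> bool" where
  "initial P s \<longleftrightarrow> iter s = 0 \<and> yseq s 0 \<in> Yset P \<and> Tset s = {} \<and> Sset s = {} \<and>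
     UB s = \<infinity> \<and> LB s = (INF y \<in> Ybar P. Jval P y)"

definition best :: "('nx::finite, 'ny::finite) minlp \<Rightarrow> ('nx, 'ny) state \<Rightarrow> nat" where
  "best P s =
     (if Tset s \<noteq> {}
      then LEAST b. is_arg_min (\<lambda>i. Jval P (yseq s i)) (\<lambda>i. i \<in> Tset s) b
      else LEAST b. is_arg_min (\<lambda>i. (norm (ybar_seq s i - yseq s i))\<^sup>2) (\<lambda>i. i \<in> Sset s) b)"

definition y_best :: "('nx::finite, 'ny::finite) minlp \<Rightarrow> ('nx, 'ny) state \<Rightarrow> real^'ny" where
  "y_best P s = yseq s (best P s)"

definition x_best :: "('nx::finite, 'ny::finite) minlp \<Rightarrow> ('nx, 'ny) state \<Rightarrow> real^'nx" where
  "x_best P s = xseq s (best P s)"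

definition incumbent ::
  "('nx::finite, 'ny::finite) minlp \<Rightarrow> ('nx, 'ny) state \<Rightarrow> ((real^'nx) \<times> (real^'ny)) option" where
  "incumbent P s = (if Tset s = {} then None else Some (x_best P s, y_best P s))"

inductive process_point ::
  "('nx::finite, 'ny::finite) minlp \<Rightarrow> ('nx, 'ny) state \<Rightarrow> ('nx, 'ny) state \<Rightarrow> bool"
  for P s where
  feasible:
    "\<lbrakk>k = iter s; nlp_set P (yseq s k) \<noteq> {}; nlp_sol P (yseq s k) x; KKT P (yseq s k) x lam mu\<rbrakk> \<Longrightarrow>
     process_point P s
       (s\<lparr>xseq := (xseq s)(k := x),
          gradJ_seq := (gradJ_seq s)(k := gradJ P (yseq s k) x lam mu),
          Tset := insert k (Tset s),
          UB := (if Jval P (yseq s k) < UB s then Jval P (yseq s k) else UB s)\<rparr>)"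
| infeasible:
    "\<lbrakk>k = iter s; nlp_set P (yseq s k) = {};
      fnlp_sol P (yseq s k) (map_option snd (incumbent P s)) (x, yb)\<rbrakk> \<Longrightarrow>
     process_point P s
       (s\<lparr>xseq := (xseq s)(k := x),
          ybar_seq := (ybar_seq s)(k := yb),
          Sset := insert k (Sset s)\<rparr>)"

definition grad_corr ::
  "('nx::finite, 'ny::finite) minlp \<Rightarrow> real^'ny^'ny \<Rightarrow> ('nx, 'ny) state \<Rightarrow> nat \<Rightarrow> real^'ny" where
  "grad_corr P W s i =
     (ARG_MIN (\<lambda>g. 1/2 * quad_form W (g - gradJ_seq s i)) g.
        Jval P (yseq s i) + ereal (g \<bullet> (y_best P s - yseq s i)) \<le> Jval P (y_best P s))"

definition cut_grad ::
  "('nx::finite, 'ny::finite) minlp \<Rightarrow> real^'ny^'ny \<Rightarrow> real \<Rightarrow> ('nx, 'ny) state \<Rightarrow> nat \<Rightarrow> real^'ny"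
  where
  "cut_grad P W \<rho> s i =
     (if Jval P (yseq s i) + ereal (gradJ_seq s i \<bullet> (y_best P s - yseq s i)) > Jval P (y_best P s)
      then \<rho> *\<^sub>R grad_corr P W s i
      else gradJ_seq s i)"

definition cut_normal ::
  "('nx::finite, 'ny::finite) minlp \<Rightarrow> real^'ny^'ny \<Rightarrow> ('nx, 'ny) state \<Rightarrow> nat \<Rightarrow> real^'ny" where
  "cut_normal P W s i =
     (if Tset s \<noteq> {}
      then (ARG_MIN (\<lambda>n. 1/2 * quad_form W (n - (yseq s i - ybar_seq s i))) n.
              n \<bullet> (y_best P s - ybar_seq s i) \<le> 0)
      else yseq s i - ybar_seq s i)"

definition Jbar :: "('nx::finite, 'ny::finite) minlp \<Rightarrow> real \<Rightarrow> ('nx, 'ny) state \<Rightarrow> ereal" where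
  "Jbar P \<alpha> s = ereal \<alpha> * Jval P (y_best P s) + ereal (1 - \<alpha>) * LB s"

definition linearized_constraints ::
  "('nx::finite, 'ny::finite) minlp \<Rightarrow> ('nx, 'ny) state \<Rightarrow> (real^'nx) \<times> (real^'ny) \<Rightarrow> bool" where
  "linearized_constraints P s z \<longleftrightarrow>
     (\<forall>i<n_ineq P. linearization (ineq P i) (x_best P s, y_best P s) z \<le> 0) \<and>
     (\<forall>j<n_eqn P. linearization (eqn P j) (x_best P s, y_best P s) z = 0)"

definition br_set ::
  "('nx::finite, 'ny::finite) minlp \<Rightarrow> real^'ny^'ny \<Rightarrow> real \<Rightarrow> real \<Rightarrow> ('nx, 'ny) state
    \<Rightarrow> ((real^'nx) \<times> (real^'ny)) set" where
  "br_set P W \<rho> \<alpha> s =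
     {(x, y). x \<in> Xset P \<and> y \<in> Yset P \<and> linearized_constraints P s (x, y) \<and>
        (\<forall>i\<in>Tset s. Jval P (yseq s i) + ereal (cut_grad P W \<rho> s i \<bullet> (y - yseq s i)) \<le> Jbar P \<alpha> s) \<and>
        (\<forall>i\<in>Sset s. cut_normal P W s i \<bullet> (y - ybar_seq s i) \<le> 0)}"

text \<open>The matrix \<open>B b\<close> belongs to the best index \<open>b\<close>. It stands for an approximation of the Hessian
  of the Lagrangian, but only symmetry and positive semidefiniteness are ever required.\<close>

definition br_obj ::
  "('nx::finite, 'ny::finite) minlp \<Rightarrow> (nat \<Rightarrow> real^('nx + 'ny)^('nx + 'ny)) \<Rightarrow> ('nx, 'ny) state
    \<Rightarrow> (real^'nx) \<times> (real^'ny) \<Rightarrow> real" where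
  "br_obj P B s = (\<lambda>(x, y).
     linearization (obj P) (x_best P s, y_best P s) (x, y)
       + 1/2 * quad_form (B (best P s)) (stack (x - x_best P s) (y - y_best P s)))"

definition br_sol ::
  "('nx::finite, 'ny::finite) minlp \<Rightarrow> real^'ny^'ny \<Rightarrow> real \<Rightarrow> real
    \<Rightarrow> (nat \<Rightarrow> real^('nx + 'ny)^('nx + 'ny)) \<Rightarrow> ('nx, 'ny) state
    \<Rightarrow> (real^'nx) \<times> (real^'ny) \<Rightarrow> bool" where
  "br_sol P W \<rho> \<alpha> B s z \<longleftrightarrow> is_arg_min (br_obj P B s) (\<lambda>z. z \<in> br_set P W \<rho> \<alpha> s) z"

definition milp_set ::
  "('nx::finite, 'ny::finite) minlp \<Rightarrow> real^'ny^'ny \<Rightarrow> real \<Rightarrow> ('nx, 'ny) state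
    \<Rightarrow> (real \<times> (real^'nx) \<times> (real^'ny)) set" where
  "milp_set P W \<rho> s =
     {(\<eta>, x, y). x \<in> Xset P \<and> y \<in> Yset P \<and>
        (best P s \<in> Tset s \<longrightarrow>
           \<eta> \<ge> linearization (obj P) (x_best P s, y_best P s) (x, y) \<and>
           linearized_constraints P s (x, y)) \<and>
        (\<forall>i\<in>Tset s - {best P s}.
           ereal \<eta> \<ge> Jval P (yseq s i) + ereal (cut_grad P W \<rho> s i \<bullet> (y - yseq s i))) \<and>
        (\<forall>i\<in>Sset s. 0 \<ge> cut_normal P W s i \<bullet> (y - ybar_seq s i))}"

definition milp_sol ::
  "('nx::finite, 'ny::finite) minlp \<Rightarrow> real^'ny^'ny \<Rightarrow> real \<Rightarrow> ('nx, 'ny) state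
    \<Rightarrow> real \<times> (real^'nx) \<times> (real^'ny) \<Rightarrow> bool" where
  "milp_sol P W \<rho> s z \<longleftrightarrow> is_arg_min (\<lambda>(\<eta>, x, y). \<eta>) (\<lambda>z. z \<in> milp_set P W \<rho> s) z"

definition br_phase :: "('nx::finite, 'ny::finite) minlp \<Rightarrow> ('nx, 'ny) state \<Rightarrow> bool" where
  "br_phase P s \<longleftrightarrow> iter s - best P s \<le> 1"

definition milp_phase ::
  "('nx::finite, 'ny::finite) minlp \<Rightarrow> real^'ny^'ny \<Rightarrow> real \<Rightarrow> real \<Rightarrow> ('nx, 'ny) state \<Rightarrow> bool" where
  "milp_phase P W \<rho> \<alpha> s \<longleftrightarrow> iter s - best P s > 1 \<or> br_set P W \<rho> \<alpha> s = {}"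

definition advance :: "('nx::finite, 'ny::finite) state \<Rightarrow> real^'ny \<Rightarrow> ereal \<Rightarrow> ('nx, 'ny) state" where
  "advance s y L = s\<lparr>iter := Suc (iter s), yseq := (yseq s)(Suc (iter s) := y), LB := L\<rparr>"

definition raise_LB :: "('nx::finite, 'ny::finite) state \<Rightarrow> ereal \<Rightarrow> ereal" where
  "raise_LB s V = (if V > LB s then V else LB s)"

text \<open>When the MILP is infeasible no new point is computed and
  the loop is left, so the next point is immaterial; the current one is kept.
  With \<open>Tset s = {}\<close> the MILP is unbounded in \<open>\<eta>\<close>: any feasible point is returned and
  its value is \<open>-\<infinity>\<close>.\<close>

inductive solve_master ::
  "('nx::finite, 'ny::finite) minlp \<Rightarrow> real^'ny^'ny \<Rightarrow> real \<Rightarrow> real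
    \<Rightarrow> (nat \<Rightarrow> real^('nx + 'ny)^('nx + 'ny)) \<Rightarrow> ('nx, 'ny) state \<Rightarrow> ('nx, 'ny) state \<Rightarrow> bool"
  for P W \<rho> \<alpha> B s where
  br:
    "\<lbrakk>br_phase P s; br_sol P W \<rho> \<alpha> B s (x, y)\<rbrakk> \<Longrightarrow>
     solve_master P W \<rho> \<alpha> B s (advance s y (LB s))"
| milp_infeasible:
    "\<lbrakk>milp_phase P W \<rho> \<alpha> s; milp_set P W \<rho> s = {}\<rbrakk> \<Longrightarrow>
     solve_master P W \<rho> \<alpha> B s (advance s (yseq s (iter s)) \<infinity>)"
| milp_bounded:
    "\<lbrakk>milp_phase P W \<rho> \<alpha> s; Tset s \<noteq> {}; milp_sol P W \<rho> s (V, x, y)\<rbrakk> \<Longrightarrow>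
     solve_master P W \<rho> \<alpha> B s (advance s y (raise_LB s (ereal V)))"
| milp_unbounded:
    "\<lbrakk>milp_phase P W \<rho> \<alpha> s; Tset s = {}; (\<eta>, x, y) \<in> milp_set P W \<rho> s\<rbrakk> \<Longrightarrow>
     solve_master P W \<rho> \<alpha> B s (advance s y (raise_LB s (-\<infinity>)))"

definition running :: "('nx::finite, 'ny::finite) state \<Rightarrow> bool" where
  "running s \<longleftrightarrow> LB s < UB s"

definition iteration ::
  "('nx::finite, 'ny::finite) minlp \<Rightarrow> real^'ny^'ny \<Rightarrow> real \<Rightarrow> real
    \<Rightarrow> (nat \<Rightarrow> real^('nx + 'ny)^('nx + 'ny)) \<Rightarrow> ('nx, 'ny) state \<Rightarrow> ('nx, 'ny) state \<Rightarrow> bool" where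
  "iteration P W \<rho> \<alpha> B s s' \<longleftrightarrow>
     running s \<and> (\<exists>m. process_point P s m \<and> solve_master P W \<rho> \<alpha> B m s')"

text \<open>An execution goes on as long as an iteration can be carried out; states after the last
  iteration are arbitrary. Multiple optimal solutions and multipliers make \<^const>\<open>iteration\<close>
  nondeterministic.\<close>

definition execution ::
  "('nx::finite, 'ny::finite) minlp \<Rightarrow> real^'ny^'ny \<Rightarrow> real \<Rightarrow> real
    \<Rightarrow> (nat \<Rightarrow> real^('nx + 'ny)^('nx + 'ny)) \<Rightarrow> (nat \<Rightarrow> ('nx, 'ny) state) \<Rightarrow> bool" where
  "execution P W \<rho> \<alpha> B st \<longleftrightarrow> initial P (st 0) \<and>
     (\<forall>n. (\<exists>s'. iteration P W \<rho> \<alpha> B (st n) s') \<longrightarrow> iteration P W \<rho> \<alpha> B (st n) (st (Suc n)))"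

text \<open>The standing convention on the subproblems met in the iteration starting at \<open>s\<close>: the feasible
  ones have optimal solutions, and KKT multipliers exist. The correction problems need no such
  convention, as they minimize a positive definite quadratic over a nonempty closed halfspace or the
  whole space.\<close>

definition subproblems_solvable ::
  "('nx::finite, 'ny::finite) minlp \<Rightarrow> real^'ny^'ny \<Rightarrow> real \<Rightarrow> real
    \<Rightarrow> (nat \<Rightarrow> real^('nx + 'ny)^('nx + 'ny)) \<Rightarrow> ('nx, 'ny) state \<Rightarrow> bool" where
  "subproblems_solvable P W \<rho> \<alpha> B s \<longleftrightarrow>
     (let y = yseq s (iter s); inc = map_option snd (incumbent P s) in
       (nlp_set P y \<noteq> {} \<longrightarrow>
          (\<exists>x. nlp_sol P y x) \<and> (\<forall>x. nlp_sol P y x \<longrightarrow> (\<exists>lam mu. KKT P y x lam mu))) \<and>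
       (nlp_set P y = {} \<and> fnlp_set P y inc \<noteq> {} \<longrightarrow> (\<exists>z. fnlp_sol P y inc z))) \<and>
     (\<forall>m. process_point P s m \<longrightarrow>
       (br_phase P m \<and> br_set P W \<rho> \<alpha> m \<noteq> {} \<longrightarrow> (\<exists>z. br_sol P W \<rho> \<alpha> B m z)) \<and>
       (milp_phase P W \<rho> \<alpha> m \<and> Tset m \<noteq> {} \<and> milp_set P W \<rho> m \<noteq> {} \<longrightarrow>
          (\<exists>z. milp_sol P W \<rho> m z)))"

definition relaxation_solvable :: "('nx::finite, 'ny::finite) minlp \<Rightarrow> bool" where
  "relaxation_solvable P \<longleftrightarrow>
     (relaxed_set P \<noteq> {} \<longrightarrow> (\<exists>z. is_arg_min (obj P) (\<lambda>z. z \<in> relaxed_set P) z))"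

end

theory Submission
  imports Defs
begin

text \<open>
  A point that has been processed is never visited again while the loop is running, so the loop ends
  because \<open>Y\<close> is finite. The argument rests on two observations.

  The incumbent constraint of the feasibility problem is redundant: the projection onto the
  convex set \<open>Fbar\<close> is nonexpansive and fixes the incumbent. Hence \<open>ybar\<close> is the projection of \<open>y\<close>
  onto \<open>Fbar\<close>, the infeasibility cuts are valid for \<open>Fbar\<close>, and their correction never changes them.

  A Benders cut evaluated at its own point \<open>y\<^sub>i\<close> does not involve the (corrected, amplified) gradient:
  it bounds \<open>J(y\<^sub>i)\<close> by \<open>Jbar < UB\<close> in the quadratic master problem, and forces \<open>\<eta> \<ge> J(y\<^sub>i) \<ge> UB\<close> in
  the linear one. At the best point, \<open>\<eta> \<ge> UB\<close> follows from the KKT conditions. Revisiting \<open>y\<^sub>i\<close> is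
  therefore impossible or closes the gap.
\<close>

section \<open>Values and feasible parameters of the parametric problem\<close>

lemma Jval_nlp_sol:
  assumes "nlp_sol P y x"
  shows "Jval P y = ereal (obj P (x, y))"
  unfolding Jval_def using assms
  by (intro antisym INF_lower INF_greatest) (auto simp: nlp_sol_def is_arg_min_linorder)

lemma Fbar_iff: "y \<in> Fbar P \<longleftrightarrow> y \<in> Ybar P \<and> nlp_set P y \<noteq> {}"
  by (auto simp: Fbar_def nlp_set_def)

section \<open>Variational inequalities for nearest points\<close>

text \<open>The squared distance to \<open>a\<close> along the segment is a quadratic in
  \<open>t\<close> with linear coefficient \<open>-2 * c\<close>; if \<open>c\<close> were positive
  it would decrease at first. Testing only an initial piece of the segment allows for a
  \<open>z\<close> that violates a further constraint.\<close>

lemma obtuse_of_closest_in_segment: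
  fixes a p z :: "'a::real_inner"
  assumes "0 < e" "e \<le> 1"
    and closest: "\<And>t. 0 < t \<Longrightarrow> t \<le> e \<Longrightarrow> norm (p - a) \<le> norm (p + t *\<^sub>R (z - p) - a)"
  shows "(a - p) \<bullet> (z - p) \<le> 0"
proof (rule ccontr)
  define c q where "c = (a - p) \<bullet> (z - p)" and "q = (z - p) \<bullet> (z - p)"
  assume "\<not> (a - p) \<bullet> (z - p) \<le> 0"
  hence c: "c > 0" by (simp add: c_def)
  hence q: "q > 0" by (auto simp: c_def q_def)
  \<comment> \<open>The quadratic is minimal at \<open>c / q\<close>; up to there the square has
    dropped by at least \<open>t * c\<close>.\<close>
  define t where "t = min e (c / q)"
  have t: "0 < t" "t \<le> e" "t * q \<le> c"
    using c q assms(1) by (auto simp: t_def min_def field_simps)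
  have "(norm (p + t *\<^sub>R (z - p) - a))\<^sup>2 = (norm (p - a))\<^sup>2 - 2 * t * c + t * (t * q)"
    unfolding power2_norm_eq_inner c_def q_def
    by (simp add: algebra_simps inner_commute)
  moreover have "(norm (p - a))\<^sup>2 \<le> (norm (p + t *\<^sub>R (z - p) - a))\<^sup>2"
    using closest[OF t(1,2)] by (simp add: power_mono)
  moreover have "t * (t * q) \<le> t * c" "t * c > 0" using t c by auto
  ultimately show False by linarith
qed

lemma obtuse_of_closest:
  fixes C :: "'a::real_inner set"
  assumes "convex C" "p \<in> C" "z \<in> C" "\<And>y. y \<in> C \<Longrightarrow> norm (p - a) \<le> norm (y - a)"
  shows "(a - p) \<bullet> (z - p) \<le> 0"
proof (rule obtuse_of_closest_in_segment[of 1])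
  fix t :: real assume "0 < t" "t \<le> 1"
  have "p + t *\<^sub>R (z - p) = (1 - t) *\<^sub>R p + t *\<^sub>R z" by (simp add: algebra_simps)
  hence "p + t *\<^sub>R (z - p) \<in> C"
    using convexD_alt[OF assms(1-3)] \<open>0 < t\<close> \<open>t \<le> 1\<close> by simp
  thus "norm (p - a) \<le> norm (p + t *\<^sub>R (z - p) - a)" by (rule assms(4))
qed auto

text \<open>Here \<open>p\<close> competes only with points of \<open>C\<close> in a ball around
  \<open>b\<close>, while \<open>z\<close> may lie outside it. Comparison with the centre
  \<open>b\<close> shows that the ball constraint is inactive at \<open>p\<close>, so a short move
  towards \<open>z\<close> stays admissible.\<close>

lemma obtuse_of_closest_in_ball:
  fixes C :: "'a::real_inner set"
  assumes C: "convex C" and p: "p \<in> C" "norm (b - p) \<le> norm (b - a)"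
    and b: "b \<in> C" and z: "z \<in> C"
    and closest: "\<And>y. y \<in> C \<Longrightarrow> norm (b - y) \<le> norm (b - a) \<Longrightarrow> norm (p - a) \<le> norm (y - a)"
  shows "(a - p) \<bullet> (z - p) \<le> 0"
proof (cases "p = a")
  case False
  have "convex (C \<inter> cball b (norm (b - a)))" using C by (simp add: convex_Int)
  hence "(a - p) \<bullet> (b - p) \<le> 0"
    by (rule obtuse_of_closest) (use p b closest in \<open>auto simp: dist_norm\<close>)
  \<comment> \<open>Expansion of \<open>b - a\<close> as the difference of \<open>b - p\<close> and
    \<open>a - p\<close>; the obtuse angle makes the middle term nonnegative.\<close>
  moreover have "(norm (b - a))\<^sup>2 = (norm (b - p))\<^sup>2 - 2 * ((a - p) \<bullet> (b - p)) + (norm (a - p))\<^sup>2"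
    unfolding power2_norm_eq_inner by (simp add: algebra_simps inner_commute)
  moreover have "(norm (a - p))\<^sup>2 > 0" using False by simp
  ultimately have "(norm (b - p))\<^sup>2 < (norm (b - a))\<^sup>2" by linarith
  hence less: "norm (b - p) < norm (b - a)" by (rule power2_less_imp_less) simp
  \<comment> \<open>The slack of the ball constraint over the length of the segment; the
    \<open>+ 1\<close> keeps the denominator positive when \<open>z = p\<close>.\<close>
  define e where "e = min 1 ((norm (b - a) - norm (b - p)) / (norm (z - p) + 1))"
  show ?thesis
  proof (rule obtuse_of_closest_in_segment[of e])
    show "0 < e" "e \<le> 1" using less by (auto simp: e_def intro!: divide_pos_pos add_nonneg_pos)
    fix t assume t: "0 < t" "t \<le> e"
    have eq: "p + t *\<^sub>R (z - p) = (1 - t) *\<^sub>R p + t *\<^sub>R z" by (simp add: algebra_simps)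
    hence "p + t *\<^sub>R (z - p) \<in> C"
      using convexD_alt[OF C p(1) z] t \<open>e \<le> 1\<close> by simp
    moreover have "norm (b - (p + t *\<^sub>R (z - p))) \<le> norm (b - a)"
    proof -
      have "norm (b - (p + t *\<^sub>R (z - p))) \<le> norm (b - p) + t * norm (z - p)"
        using norm_triangle_ineq4[of "b - p" "t *\<^sub>R (z - p)"] t by (simp add: diff_diff_eq)
      also have "t * norm (z - p) \<le> t * (norm (z - p) + 1)" using t by simp
      also have "\<dots> \<le> norm (b - a) - norm (b - p)"
      proof -
        have "t \<le> (norm (b - a) - norm (b - p)) / (norm (z - p) + 1)"
          using t by (simp add: e_def)
        thus ?thesis by (subst (asm) pos_le_divide_eq) (auto intro: add_nonneg_pos)
      qed
      finally show ?thesis by simp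
    qed
    ultimately show "norm (p - a) \<le> norm (p + t *\<^sub>R (z - p) - a)" by (rule closest)
  qed
qed simp

section \<open>The feasibility problem and the correction problem\<close>

lemma fnlp_sol_in_Fbar:
  assumes "fnlp_sol P yhat inc (x, yb)"
  shows "yb \<in> Fbar P"
  using assms by (auto simp: fnlp_sol_def is_arg_min_def fnlp_set_def Fbar_iff)

text \<open>The point \<open>z\<close> ranges over all of \<open>Fbar P\<close>, including points
  cut off by the incumbent constraint. The inequality therefore characterizes the projection onto
  \<open>Fbar P\<close> and stays usable when the incumbent changes later.\<close>

lemma fnlp_sol_obtuse:
  assumes "convex (Fbar P)" "fnlp_sol P yhat inc (x, yb)" "z \<in> Fbar P"
    and "\<And>y. inc = Some y \<Longrightarrow> y \<in> Fbar P"
  shows "(yhat - yb) \<bullet> (z - yb) \<le> 0"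
proof -
  have le: "norm (yb - yhat) \<le> norm (v - yhat)" if "(u, v) \<in> fnlp_set P yhat inc" for u v
    by (rule power2_le_imp_le) (use assms(2) that in \<open>auto simp: fnlp_sol_def is_arg_min_linorder\<close>)
  have sol: "(x, yb) \<in> fnlp_set P yhat inc"
    using assms(2) by (auto simp: fnlp_sol_def is_arg_min_linorder)
  have yb: "yb \<in> Fbar P" using assms(2) by (rule fnlp_sol_in_Fbar)
  show ?thesis
  proof (cases inc)
    case None
    have "norm (yb - yhat) \<le> norm (y - yhat)" if "y \<in> Fbar P" for y
      using that le by (auto simp: fnlp_set_def Fbar_iff None)
    thus ?thesis by (rule obtuse_of_closest[OF assms(1) yb assms(3)])
  next
    case (Some b)
    have "norm (yb - yhat) \<le> norm (y - yhat)"
      if "y \<in> Fbar P" "norm (b - y) \<le> norm (b - yhat)" for y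
      using that le power_mono[OF that(2), of 2]
      by (auto simp: fnlp_set_def Fbar_iff Some)
    moreover have "norm (b - yb) \<le> norm (b - yhat)"
      using sol by (auto simp: fnlp_set_def Some intro: power2_le_imp_le)
    ultimately show ?thesis
      using obtuse_of_closest_in_ball[OF assms(1) yb] assms(3,4) Some by blast
  qed
qed

text \<open>The objective is zero at \<open>n0\<close> and positive elsewhere, so an admissible
  \<open>n0\<close> is the only minimizer and the choice in \<open>ARG_MIN\<close> is
  determined.\<close>

lemma arg_min_quad_form_unconstrained:
  assumes W: "pos_def W" and Q: "Q n0"
  shows "(ARG_MIN (\<lambda>n. 1/2 * quad_form W (n - n0)) n. Q n) = n0"
proof -
  have pos: "quad_form W v > 0" if "v \<noteq> 0" for v using W that by (auto simp: pos_def_def)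
  have zero: "quad_form W 0 = 0" by (simp add: quad_form_def)
  have "is_arg_min (\<lambda>n. 1/2 * quad_form W (n - n0)) Q n \<longleftrightarrow> n = n0" for n
  proof
    assume "is_arg_min (\<lambda>n. 1/2 * quad_form W (n - n0)) Q n"
    hence "quad_form W (n - n0) \<le> 0" using Q zero by (force simp: is_arg_min_linorder)
    thus "n = n0" using pos[of "n - n0"] by (cases "n = n0") auto
  next
    assume "n = n0"
    moreover have "quad_form W v \<ge> 0" for v using pos[of v] zero by (cases "v = 0") auto
    ultimately show "is_arg_min (\<lambda>n. 1/2 * quad_form W (n - n0)) Q n"
      using Q zero by (simp add: is_arg_min_linorder)
  qed
  hence "is_arg_min (\<lambda>n. 1/2 * quad_form W (n - n0)) Q = (\<lambda>n. n = n0)" by blast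
  thus ?thesis unfolding arg_min_def by (simp only: some_eq_trivial)
qed

section \<open>Soundness of the stored data\<close>

definition sound_history :: "('nx::finite, 'ny::finite) minlp \<Rightarrow> ('nx, 'ny) state \<Rightarrow> bool" where
  "sound_history P s \<longleftrightarrow>
     finite (Tset s) \<and>
     (\<forall>i\<in>Tset s. yseq s i \<in> Yset P \<and> nlp_sol P (yseq s i) (xseq s i) \<and>
        (\<exists>lam mu. KKT P (yseq s i) (xseq s i) lam mu)) \<and>
     (\<forall>i\<in>Sset s. yseq s i \<notin> Fbar P \<and> ybar_seq s i \<in> Fbar P \<and>
        (\<forall>z\<in>Fbar P. (yseq s i - ybar_seq s i) \<bullet> (z - ybar_seq s i) \<le> 0)) \<and>
     UB s = (INF i\<in>Tset s. Jval P (yseq s i))"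

lemma sound_history_best:
  assumes "sound_history P s" "Tset s \<noteq> {}"
  shows "best P s \<in> Tset s" "UB s = Jval P (y_best P s)"
    "UB s = ereal (obj P (x_best P s, y_best P s))"
    "(x_best P s, y_best P s) \<in> minlp_set P" "y_best P s \<in> Fbar P"
proof -
  \<comment> \<open>The \<open>LEAST\<close> in \<open>best\<close> is meaningful only if a
    minimizer exists, which finiteness of \<open>Tset s\<close> ensures.\<close>
  have "is_arg_min (\<lambda>i. Jval P (yseq s i)) (\<lambda>i. i \<in> Tset s) (best P s)"
    unfolding best_def using assms LeastI_ex[OF ex_is_arg_min_if_finite]
    by (auto simp: sound_history_def)
  hence T: "best P s \<in> Tset s" and le: "\<And>i. i \<in> Tset s \<Longrightarrow> Jval P (y_best P s) \<le> Jval P (yseq s i)"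
    by (auto simp: is_arg_min_linorder y_best_def)
  show "best P s \<in> Tset s" by fact
  have "(INF i\<in>Tset s. Jval P (yseq s i)) = Jval P (y_best P s)"
    using T le by (intro antisym INF_greatest INF_lower2[OF T]) (auto simp: y_best_def)
  thus UB: "UB s = Jval P (y_best P s)" using assms by (simp add: sound_history_def)
  have sol: "y_best P s \<in> Yset P" "nlp_sol P (y_best P s) (x_best P s)"
    using assms(1) T by (auto simp: sound_history_def y_best_def x_best_def)
  show "UB s = ereal (obj P (x_best P s, y_best P s))"
    using UB Jval_nlp_sol[OF sol(2)] by simp
  show "(x_best P s, y_best P s) \<in> minlp_set P"
    using sol by (simp add: minlp_set_def nlp_sol_def is_arg_min_def)
  thus "y_best P s \<in> Fbar P" by (auto simp: minlp_set_def Yset_def Fbar_iff)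
qed

lemma incumbent_in_Fbar:
  assumes "sound_history P s" "map_option snd (incumbent P s) = Some y"
  shows "y \<in> Fbar P"
  using assms sound_history_best(5)[OF assms(1)] by (auto simp: incumbent_def split: if_splits)

lemma sound_history_UB_le:
  assumes "sound_history P s" "i \<in> Tset s"
  shows "UB s \<le> Jval P (yseq s i)"
  using assms by (auto simp: sound_history_def intro: INF_lower)

lemma Tset_empty_UB: "sound_history P s \<Longrightarrow> Tset s = {} \<Longrightarrow> UB s = \<infinity>"
  by (simp add: sound_history_def top_ereal_def)

text \<open>The best feasible point lies in \<open>Fbar P\<close>, so the stored normal already
  satisfies the constraint of its correction problem.\<close>

lemma cut_normal_eq:
  assumes "sound_history P s" "pos_def W" "i \<in> Sset s"
  shows "cut_normal P W s i = yseq s i - ybar_seq s i"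
proof (cases "Tset s = {}")
  case False
  have "(yseq s i - ybar_seq s i) \<bullet> (y_best P s - ybar_seq s i) \<le> 0"
    using assms sound_history_best(5)[OF assms(1) False] by (auto simp: sound_history_def)
  thus ?thesis using arg_min_quad_form_unconstrained[OF assms(2)] False
    by (simp add: cut_normal_def)
qed (simp add: cut_normal_def)

lemma infeasibility_cut_valid:
  assumes "sound_history P s" "pos_def W" "i \<in> Sset s" "y \<in> Fbar P"
  shows "cut_normal P W s i \<bullet> (y - ybar_seq s i) \<le> 0"
  using assms by (auto simp: cut_normal_eq sound_history_def)

text \<open>At its own point the cut bounds the squared norm of its normal by zero. That point would
  then equal its projection, although only the projection lies in \<open>Fbar P\<close>.\<close>

lemma infeasibility_cut_excludes:
  assumes "sound_history P s" "pos_def W" "i \<in> Sset s"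
    "cut_normal P W s i \<bullet> (y - ybar_seq s i) \<le> 0"
  shows "y \<noteq> yseq s i"
proof
  assume "y = yseq s i"
  hence "yseq s i = ybar_seq s i" using assms
    by (simp add: cut_normal_eq flip: power2_norm_eq_inner)
  thus False using assms by (auto simp: sound_history_def)
qed

lemma process_point_sound:
  assumes "process_point P s m" "sound_history P s" "convex (Fbar P)"
    "yseq s (iter s) \<in> Yset P" "Tset s \<union> Sset s = {..<iter s}"
  shows "sound_history P m" "Tset m \<union> Sset m = {..iter s}"
    "iter m = iter s" "yseq m = yseq s" "LB m = LB s"
proof -
  \<comment> \<open>The current index is fresh, so writing at it preserves all stored entries; the
    conditional update of \<open>UB\<close> is the minimum of the old infimum and the new
    value.\<close>
  have iter: "iter s \<notin> Tset s" "iter s \<notin> Sset s" using assms(5) by auto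
  have insert: "insert (iter s) {..<iter s} = {..iter s}" by auto
  show "Tset m \<union> Sset m = {..iter s}" "iter m = iter s" "yseq m = yseq s" "LB m = LB s"
    using assms(1) by (cases; use assms(5) insert in auto)+
  show "sound_history P m"
    using assms(1)
  proof cases
    case (feasible k x lam mu)
    thus ?thesis using assms(2,4) iter
      by (auto simp: sound_history_def INF_insert min_def)
  next
    case (infeasible k x yb)
    note obtuse = fnlp_sol_obtuse[OF assms(3) infeasible(4) _ incumbent_in_Fbar[OF assms(2)]]
    have "yb \<in> Fbar P" using infeasible(4) by (rule fnlp_sol_in_Fbar)
    thus ?thesis using assms(2) iter infeasible obtuse
      by (auto simp: sound_history_def Fbar_iff)
  qed
qed

section \<open>Master problems at points already processed\<close>

text \<open>Take the inner product of KKT stationarity with \<open>x - xb\<close>. The equality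
  terms vanish and the inequality terms are nonpositive by complementarity, so the objective term is
  nonnegative.\<close>

lemma linearized_obj_ge:
  assumes KKT: "KKT P yb xb lam mu"
    and g: "\<And>i. i < n_ineq P \<Longrightarrow> linearization (ineq P i) (xb, yb) (x, yb) \<le> 0"
    and h: "\<And>j. j < n_eqn P \<Longrightarrow> linearization (eqn P j) (xb, yb) (x, yb) = 0"
    and eqn: "\<And>j. j < n_eqn P \<Longrightarrow> eqn P j (xb, yb) = 0"
  shows "linearization (obj P) (xb, yb) (x, yb) \<ge> obj P (xb, yb)"
proof -
  \<comment> \<open>Both points share \<open>yb\<close>, so only the x-part of the gradient
    contributes.\<close>
  have lin: "linearization F (xb, yb) (x, yb) = F (xb, yb) + grad_x F xb yb \<bullet> (x - xb)"
    for F :: "(real^'a) \<times> (real^'b) \<Rightarrow> real"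
    by (cases "grad F (xb, yb)") (simp add: linearization_def grad_x_def)
  have "(grad_x (obj P) xb yb + (\<Sum>i<n_ineq P. lam i *\<^sub>R grad_x (ineq P i) xb yb)
      + (\<Sum>j<n_eqn P. mu j *\<^sub>R grad_x (eqn P j) xb yb)) \<bullet> (x - xb) = 0"
    using KKT by (simp add: KKT_def)
  hence "grad_x (obj P) xb yb \<bullet> (x - xb)
      + (\<Sum>i<n_ineq P. lam i * (grad_x (ineq P i) xb yb \<bullet> (x - xb)))
      + (\<Sum>j<n_eqn P. mu j * (grad_x (eqn P j) xb yb \<bullet> (x - xb))) = 0"
    by (simp add: inner_add_left inner_sum_left)
  moreover have "(\<Sum>j<n_eqn P. mu j * (grad_x (eqn P j) xb yb \<bullet> (x - xb))) = 0"
    using h eqn by (intro sum.neutral) (simp add: lin)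
  moreover have "(\<Sum>i<n_ineq P. lam i * (grad_x (ineq P i) xb yb \<bullet> (x - xb))) \<le> 0"
  proof (rule sum_nonpos)
    fix i assume "i \<in> {..<n_ineq P}"
    hence i: "i < n_ineq P" by simp
    \<comment> \<open>Complementarity lets the constraint value be added for free, which turns the
      directional term into a multiple of the linearized constraint.\<close>
    have "lam i * (ineq P i (xb, yb) + grad_x (ineq P i) xb yb \<bullet> (x - xb)) \<le> 0"
      using g[OF i] KKT i by (auto simp: lin KKT_def intro: mult_nonneg_nonpos)
    thus "lam i * (grad_x (ineq P i) xb yb \<bullet> (x - xb)) \<le> 0"
      using KKT i by (cases "lam i = 0") (auto simp: KKT_def)
  qed
  ultimately show ?thesis by (simp add: lin)
qed

text \<open>Since \<open>UB m\<close> is the value at the best point, \<open>Jbar\<close> is an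
  affine combination of \<open>UB m\<close> and \<open>LB m\<close> with positive weight on the
  smaller \<open>LB m\<close>. Both bounds are finite here, so the arithmetic takes place in the
  reals.\<close>

lemma Jbar_less_UB:
  assumes "sound_history P m" "Tset m \<noteq> {}" "LB m < UB m" "LB m > -\<infinity>" "\<alpha> < 1"
  shows "Jbar P \<alpha> m < UB m"
proof -
  define j where "j = obj P (x_best P m, y_best P m)"
  have j: "Jval P (y_best P m) = ereal j" "UB m = ereal j"
    using sound_history_best(2,3)[OF assms(1,2)] by (auto simp: j_def)
  obtain l where l: "LB m = ereal l" using assms(3,4) j by (cases "LB m") auto
  have "(1 - \<alpha>) * l < (1 - \<alpha>) * j" using assms(3,5) j l by simp
  hence "\<alpha> * j + (1 - \<alpha>) * l < j" by (simp add: algebra_simps)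
  thus ?thesis by (simp add: Jbar_def j l)
qed

lemma br_set_excludes:
  assumes "sound_history P m" "pos_def W" "\<alpha> < 1" "LB m < UB m" "LB m > -\<infinity>"
    and "(x, y) \<in> br_set P W \<rho> \<alpha> m" "i \<in> Tset m \<union> Sset m"
  shows "y \<noteq> yseq m i"
proof (cases "i \<in> Sset m")
  case True
  thus ?thesis using infeasibility_cut_excludes[OF assms(1,2)] assms(6) by (auto simp: br_set_def)
next
  case False
  hence i: "i \<in> Tset m" using assms(7) by blast
  show ?thesis
  proof
    assume "y = yseq m i"
    \<comment> \<open>The gradient is multiplied by the zero vector, whatever its correction and
      amplification.\<close>
    hence "Jval P (yseq m i) \<le> Jbar P \<alpha> m" using assms(6) i by (auto simp: br_set_def)
    moreover have "Jbar P \<alpha> m < UB m" using Jbar_less_UB assms i by blast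
    ultimately show False using sound_history_UB_le[OF assms(1) i] by auto
  qed
qed

lemma milp_set_revisit:
  assumes "sound_history P m" "pos_def W" "(\<eta>, x, y) \<in> milp_set P W \<rho> m"
    and "i \<in> Tset m \<union> Sset m" "y = yseq m i"
  shows "i \<in> Tset m" "ereal \<eta> \<ge> UB m"
proof -
  have "i \<notin> Sset m"
    using infeasibility_cut_excludes[OF assms(1,2)] assms(3,5) by (auto simp: milp_set_def)
  thus i: "i \<in> Tset m" using assms(4) by blast
  show "ereal \<eta> \<ge> UB m"
  proof (cases "i = best P m")
    case False
    hence "ereal \<eta> \<ge> Jval P (yseq m i) + ereal (cut_grad P W \<rho> m i \<bullet> (y - yseq m i))"
      using assms(3) i by (simp add: milp_set_def)
    hence "ereal \<eta> \<ge> Jval P (yseq m i)" using assms(5) by (simp flip: zero_ereal_def)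
    thus ?thesis using sound_history_UB_le[OF assms(1) i] by auto
  next
    \<comment> \<open>The best index carries no Benders cut in the linear master problem; the
      linearized objective and constraints take its place.\<close>
    case True
    hence y: "y = y_best P m" using assms(5) by (simp add: y_best_def)
    have lin: "\<eta> \<ge> linearization (obj P) (x_best P m, y_best P m) (x, y)"
      "linearized_constraints P m (x, y)"
      using assms(3) i True by (auto simp: milp_set_def)
    obtain lam mu where KKT: "KKT P (y_best P m) (x_best P m) lam mu"
      using assms(1) i True by (auto simp: sound_history_def y_best_def x_best_def)
    have "Tset m \<noteq> {}" using i by auto
    note best = sound_history_best[OF assms(1) this]
    have "obj P (x_best P m, y_best P m) \<le> linearization (obj P) (x_best P m, y_best P m) (x, y)"
      unfolding y using lin(2) best(4)
      by (intro linearized_obj_ge[OF KKT])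
        (auto simp: y linearized_constraints_def minlp_set_def nlp_set_def)
    thus ?thesis using lin(1) best(3) by simp
  qed
qed

lemma raise_LB_ge: "raise_LB s V \<ge> V" "raise_LB s V \<ge> LB s"
  by (auto simp: raise_LB_def)

text \<open>The condition is on the state after the master problem: a revisit through a linear
  master problem with a finite value lifts \<open>LB\<close> to \<open>UB\<close> and so ends the
  loop.\<close>

lemma solve_master_new_point:
  assumes "solve_master P W \<rho> \<alpha> B m s'" "sound_history P m" "pos_def W" "\<alpha> < 1"
    "LB m > -\<infinity>" "running s'" "i \<in> Tset m \<union> Sset m"
  shows "yseq s' (iter s') \<noteq> yseq m i"
  using assms(1)
proof cases
  case (br x y)
  \<comment> \<open>The quadratic master problem changes neither bound, so the gap is read off from
    \<open>running s'\<close>. The loop test before processing would not suffice, since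
    \<open>UB\<close> may have dropped since.\<close>
  hence "LB m < UB m" using assms(6) by (simp add: running_def advance_def)
  moreover have "(x, y) \<in> br_set P W \<rho> \<alpha> m" using br by (simp add: br_sol_def is_arg_min_def)
  ultimately have "y \<noteq> yseq m i" using br_set_excludes assms by blast
  thus ?thesis using br by (simp add: advance_def)
next
  case milp_infeasible
  thus ?thesis using assms(6) by (simp add: running_def advance_def)
next
  case (milp_bounded V x y)
  hence "(V, x, y) \<in> milp_set P W \<rho> m" by (simp add: milp_sol_def is_arg_min_def)
  note revisit = milp_set_revisit[OF assms(2,3) this assms(7)]
  have "ereal V < UB m" using assms(6) milp_bounded raise_LB_ge(1)[of "ereal V" m]
    by (auto simp: running_def advance_def)
  thus ?thesis using revisit(2) milp_bounded by (auto simp: advance_def)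
next
  case (milp_unbounded \<eta> x y)
  thus ?thesis using milp_set_revisit(1)[OF assms(2,3) milp_unbounded(4) assms(7)]
    by (auto simp: advance_def)
qed

lemma solve_master_frame:
  assumes "solve_master P W \<rho> \<alpha> B m s'"
  shows "iter s' = Suc (iter m)" "\<And>i. i \<le> iter m \<Longrightarrow> yseq s' i = yseq m i"
    "xseq s' = xseq m" "ybar_seq s' = ybar_seq m" "Tset s' = Tset m" "Sset s' = Sset m"
    "UB s' = UB m" "LB s' \<ge> LB m"
proof -
  obtain y L where "s' = advance m y L" "L \<ge> LB m"
    using assms by cases (rule that, assumption, simp add: raise_LB_ge)+
  thus "iter s' = Suc (iter m)" "\<And>i. i \<le> iter m \<Longrightarrow> yseq s' i = yseq m i"
    "xseq s' = xseq m" "ybar_seq s' = ybar_seq m" "Tset s' = Tset m" "Sset s' = Sset m"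
    "UB s' = UB m" "LB s' \<ge> LB m"
    by (simp_all add: advance_def)
qed

lemma solve_master_Yset:
  assumes "solve_master P W \<rho> \<alpha> B m s'" "yseq m (iter m) \<in> Yset P"
  shows "yseq s' (iter s') \<in> Yset P"
  using assms
  by cases (auto simp: advance_def br_sol_def milp_sol_def is_arg_min_def br_set_def milp_set_def)

lemma sound_history_cong:
  assumes "Tset s = Tset m" "Sset s = Sset m" "UB s = UB m" "xseq s = xseq m"
    "ybar_seq s = ybar_seq m" "\<And>i. i \<in> Tset m \<union> Sset m \<Longrightarrow> yseq s i = yseq m i"
  shows "sound_history P s \<longleftrightarrow> sound_history P m"
proof -
  have "(INF i\<in>Tset s. Jval P (yseq s i)) = (INF i\<in>Tset m. Jval P (yseq m i))"
    using assms by (intro INF_cong) auto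
  thus ?thesis using assms by (simp add: sound_history_def)
qed

text \<open>Without a feasible point so far, the linear master problem retains only
  \<open>Xset P\<close>, \<open>Yset P\<close> and the infeasibility cuts, which are valid on
  \<open>Fbar P\<close>. Its infeasibility is thus a certificate.\<close>

lemma minlp_set_empty_if_milp_set_empty:
  assumes "sound_history P m" "pos_def W" "Tset m = {}" "milp_set P W \<rho> m = {}"
  shows "minlp_set P = {}"
proof (rule ccontr)
  assume "minlp_set P \<noteq> {}"
  then obtain x y where y: "y \<in> Yset P" "x \<in> nlp_set P y" by (auto simp: minlp_set_def)
  hence "y \<in> Fbar P" by (auto simp: Yset_def Fbar_iff)
  \<comment> \<open>No constraint on \<eta> is present, so 0 is an arbitrary choice.\<close>
  hence "(0, x, y) \<in> milp_set P W \<rho> m"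
    using y assms(3) infeasibility_cut_valid[OF assms(1,2)]
    by (simp add: milp_set_def nlp_set_def)
  thus False using assms(4) by blast
qed

section \<open>The loop invariant\<close>

text \<open>The sequence \<open>yseq s\<close> is one entry ahead of the processed indices.
  Injectivity is conditional because the last iteration may repeat a point, for instance when the
  linear master problem is infeasible.\<close>

definition loop_invariant :: "('nx::finite, 'ny::finite) minlp \<Rightarrow> ('nx, 'ny) state \<Rightarrow> bool" where
  "loop_invariant P s \<longleftrightarrow>
     sound_history P s \<and> Tset s \<union> Sset s = {..<iter s} \<and>
     yseq s ` {..iter s} \<subseteq> Yset P \<and> (running s \<longrightarrow> inj_on (yseq s) {..iter s}) \<and>
     LB s > -\<infinity> \<and> (Tset s = {} \<and> LB s = \<infinity> \<longrightarrow> minlp_set P = {})"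

text \<open>An infimum in the extended reals could be minus infinity; a minimizer of a nonempty
  relaxation makes it finite.\<close>

lemma initial_LB:
  assumes "initial P s" "relaxation_solvable P"
  shows "LB s > -\<infinity>" "LB s = \<infinity> \<longleftrightarrow> relaxed_set P = {}"
proof -
  have LB: "LB s = (INF y\<in>Ybar P. Jval P y)" using assms by (simp add: initial_def)
  show "LB s > -\<infinity>" "LB s = \<infinity> \<longleftrightarrow> relaxed_set P = {}"
  proof (atomize (full), cases "relaxed_set P = {}")
    case True
    have "Jval P y = \<infinity>" if "y \<in> Ybar P" for y
    proof -
      have "nlp_set P y = {}" using True that by (auto simp: relaxed_set_def)
      thus ?thesis by (simp add: Jval_def top_ereal_def)
    qed
    hence "LB s \<ge> \<infinity>" unfolding LB by (intro INF_greatest) simp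
    thus "LB s > -\<infinity> \<and> (LB s = \<infinity> \<longleftrightarrow> relaxed_set P = {})" using True by simp
  next
    case False
    then obtain x0 y0 where sol: "(x0, y0) \<in> relaxed_set P"
      and le: "\<And>x y. (x, y) \<in> relaxed_set P \<Longrightarrow> obj P (x0, y0) \<le> obj P (x, y)"
      using assms(2) by (auto simp: relaxation_solvable_def is_arg_min_linorder)
    have "LB s \<ge> ereal (obj P (x0, y0))"
      unfolding LB Jval_def using le by (intro INF_greatest) (auto simp: relaxed_set_def)
    moreover have "LB s \<le> ereal (obj P (x0, y0))"
      unfolding LB Jval_def using sol
      by (intro INF_lower2[of y0] INF_lower2[of x0]) (auto simp: relaxed_set_def)
    ultimately show "LB s > -\<infinity> \<and> (LB s = \<infinity> \<longleftrightarrow> relaxed_set P = {})"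
      using False by (cases "LB s") auto
  qed
qed

lemma loop_invariant_initial:
  assumes "initial P s" "relaxation_solvable P"
  shows "loop_invariant P s"
proof -
  have "minlp_set P \<subseteq> relaxed_set P" by (auto simp: minlp_set_def relaxed_set_def Yset_def)
  thus ?thesis using assms(1) initial_LB[OF assms]
    by (auto simp: initial_def loop_invariant_def sound_history_def top_ereal_def)
qed

lemma loop_invariant_step:
  assumes "loop_invariant P s" "iteration P W \<rho> \<alpha> B s s'"
    "convex (Fbar P)" "pos_def W" "\<alpha> < 1"
  shows "loop_invariant P s'" "iter s' = Suc (iter s)"
proof -
  obtain m where m: "process_point P s m" and s': "solve_master P W \<rho> \<alpha> B m s'"
    and run: "running s"
    using assms(2) by (auto simp: iteration_def)
  have inv: "sound_history P s" "Tset s \<union> Sset s = {..<iter s}"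
    "yseq s ` {..iter s} \<subseteq> Yset P" "inj_on (yseq s) {..iter s}" "LB s > -\<infinity>"
    "Tset s = {} \<and> LB s = \<infinity> \<longrightarrow> minlp_set P = {}"
    using assms(1) run by (auto simp: loop_invariant_def)
  have "yseq s (iter s) \<in> Yset P" using inv(3) by auto
  note pp = process_point_sound[OF m inv(1) assms(3) this inv(2)]
  note fr = solve_master_frame[OF s', unfolded pp(3,4,5)]
  show iter: "iter s' = Suc (iter s)" by (rule fr(1))
  have eq: "yseq s' i = yseq s i" if "i \<le> iter s" for i using fr(2) that .
  have "sound_history P s'"
    using sound_history_cong[of s' m P] fr pp by auto
  moreover have "Tset s' \<union> Sset s' = {..<iter s'}"
    using fr pp(2) by (auto simp: iter)
  moreover have new: "yseq s' (Suc (iter s)) \<in> Yset P"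
    using solve_master_Yset[OF s'] inv(3) by (auto simp: pp iter)
  hence "yseq s' ` {..iter s'} \<subseteq> Yset P"
    using inv(3) eq by (auto simp: iter atMost_Suc)
  moreover have "inj_on (yseq s') {..iter s'}" if "running s'"
  proof -
    \<comment> \<open>After processing, every index up to \<open>iter s\<close> belongs to
      \<open>Tset m\<close> or \<open>Sset m\<close>.\<close>
    have "yseq s' (Suc (iter s)) \<noteq> yseq s i" if "i \<le> iter s" for i
      using solve_master_new_point[OF s' pp(1) assms(4,5) _ \<open>running s'\<close>, of i] that inv(5)
      by (simp add: pp iter)
    moreover have "inj_on (yseq s') {..iter s}"
      using inv(4) eq by (auto simp: inj_on_def)
    ultimately show ?thesis using eq by (auto simp: iter atMost_Suc)
  qed
  moreover have "LB s' > -\<infinity>" using inv(5) fr(8) by (rule less_le_trans)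
  moreover have "minlp_set P = {}" if "Tset s' = {}" "LB s' = \<infinity>"
  proof -
    have T: "Tset m = {}" using that fr by simp
    \<comment> \<open>With \<open>Tset m\<close> empty, an infinite new bound can therefore only
      stem from an infeasible linear master problem.\<close>
    have "LB m \<noteq> \<infinity>" using run pp(5) by (auto simp: running_def)
    with s' show ?thesis
      by cases (use T that minlp_set_empty_if_milp_set_empty[OF pp(1) assms(4) T] in
        \<open>auto simp: advance_def raise_LB_def\<close>)
  qed
  ultimately show "loop_invariant P s'" by (auto simp: loop_invariant_def)
qed

section \<open>Progress and termination\<close>

text \<open>Solvability is assumed for feasible subproblems only, so feasibility of the feasibility
  problem has to be shown: the incumbent is a witness, or any relaxed point if there is
  none.\<close>

lemma iteration_exists:
  assumes "loop_invariant P s" "running s" "subproblems_solvable P W \<rho> \<alpha> B s"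
    "relaxed_set P \<noteq> {}"
  shows "\<exists>s'. iteration P W \<rho> \<alpha> B s s'"
proof -
  let ?y = "yseq s (iter s)" and ?inc = "map_option snd (incumbent P s)"
  have sound: "sound_history P s" using assms(1) by (simp add: loop_invariant_def)
  have solv: "nlp_set P ?y \<noteq> {} \<Longrightarrow> \<exists>x. nlp_sol P ?y x"
    "\<And>x. nlp_set P ?y \<noteq> {} \<Longrightarrow> nlp_sol P ?y x \<Longrightarrow> \<exists>lam mu. KKT P ?y x lam mu"
    "nlp_set P ?y = {} \<Longrightarrow> fnlp_set P ?y ?inc \<noteq> {} \<Longrightarrow> \<exists>z. fnlp_sol P ?y ?inc z"
    "\<And>m. process_point P s m \<Longrightarrow> br_phase P m \<Longrightarrow> br_set P W \<rho> \<alpha> m \<noteq> {} \<Longrightarrow>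
      \<exists>z. br_sol P W \<rho> \<alpha> B m z"
    "\<And>m. process_point P s m \<Longrightarrow> milp_phase P W \<rho> \<alpha> m \<Longrightarrow> Tset m \<noteq> {} \<Longrightarrow>
      milp_set P W \<rho> m \<noteq> {} \<Longrightarrow> \<exists>z. milp_sol P W \<rho> m z"
    using assms(3) by (auto simp: subproblems_solvable_def Let_def)
  have "\<exists>m. process_point P s m"
  proof (cases "nlp_set P ?y = {}")
    case False
    thus ?thesis using solv(1,2) process_point.feasible[OF refl] by blast
  next
    case True
    have "fnlp_set P ?y ?inc \<noteq> {}"
    proof (cases ?inc)
      case None
      thus ?thesis using assms(4) by (auto simp: fnlp_set_def relaxed_set_def)
    next
      case (Some b)
      from incumbent_in_Fbar[OF sound this] obtain x where "b \<in> Ybar P" "x \<in> nlp_set P b"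
        by (auto simp: Fbar_iff)
      hence "(x, b) \<in> fnlp_set P ?y ?inc" by (simp add: fnlp_set_def Some)
      thus ?thesis by blast
    qed
    with solv(3) True obtain x yb where "fnlp_sol P ?y ?inc (x, yb)" by fast
    thus ?thesis using process_point.infeasible[OF refl True] by blast
  qed
  then obtain m where m: "process_point P s m" ..
  have "\<exists>s'. solve_master P W \<rho> \<alpha> B m s'"
  proof (cases "milp_phase P W \<rho> \<alpha> m")
    case False
    hence br: "br_phase P m" "br_set P W \<rho> \<alpha> m \<noteq> {}" by (auto simp: milp_phase_def br_phase_def)
    then obtain x y where "br_sol P W \<rho> \<alpha> B m (x, y)" using solv(4)[OF m] by fast
    thus ?thesis using solve_master.br br(1) by blast
  next
    case milp: True
    consider "milp_set P W \<rho> m = {}" | "milp_set P W \<rho> m \<noteq> {}" "Tset m = {}"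
      | "milp_set P W \<rho> m \<noteq> {}" "Tset m \<noteq> {}" by blast
    thus ?thesis
    proof cases
      case 1
      thus ?thesis using solve_master.milp_infeasible milp by blast
    next
      case 2
      then obtain \<eta> x y where "(\<eta>, x, y) \<in> milp_set P W \<rho> m" by fast
      thus ?thesis using solve_master.milp_unbounded milp 2 by blast
    next
      case 3
      then obtain V x y where "milp_sol P W \<rho> m (V, x, y)" using solv(5)[OF m milp] by fast
      thus ?thesis using solve_master.milp_bounded milp 3 by blast
    qed
  qed
  thus ?thesis using m assms(2) by (auto simp: iteration_def)
qed

lemma loop_invariant_terminated:
  assumes "loop_invariant P s" "\<not> running s"
  shows "(\<exists>x y. incumbent P s = Some (x, y) \<and> (x, y) \<in> minlp_set P \<and>
                UB s = ereal (obj P (x, y))) \<or>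
         (incumbent P s = None \<and> LB s = \<infinity> \<and> UB s = \<infinity> \<and> minlp_set P = {})"
proof (cases "Tset s = {}")
  case False
  thus ?thesis using sound_history_best(3,4)[OF _ False] assms(1)
    by (auto simp: incumbent_def loop_invariant_def)
next
  case True
  hence "UB s = \<infinity>" using assms(1) Tset_empty_UB by (auto simp: loop_invariant_def)
  thus ?thesis using True assms by (auto simp: incumbent_def loop_invariant_def running_def)
qed

theorem theorem3:
  fixes P :: "('nx::finite, 'ny::finite) minlp"
    and W :: "real^'ny^'ny"
    and \<rho> \<alpha> :: real
    and B :: "nat \<Rightarrow> real^('nx + 'ny)^('nx + 'ny)"
    and st :: "nat \<Rightarrow> ('nx, 'ny) state"
  assumes "polyhedron (Xset P)" and "polyhedron (Ybar P)"
    and "twice_cont_diff (obj P)"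
    and "\<And>i. i < n_ineq P \<Longrightarrow> twice_cont_diff (ineq P i)"
    and "\<And>j. j < n_eqn P \<Longrightarrow> twice_cont_diff (eqn P j)"
    and "finite (Yset P)"
    and "\<And>y x. y \<in> Yset P \<Longrightarrow> nlp_sol P y x \<Longrightarrow> MFCQ P y x"
    and "convex (Fbar P)"
    and "pos_def W" and "\<rho> \<ge> 1" and "0 \<le> \<alpha>" and "\<alpha> < 1"
    and "\<And>b. pos_semidef (B b)"
    and "relaxation_solvable P"
    and "execution P W \<rho> \<alpha> B st"
    and "\<And>n. \<forall>m<n. iteration P W \<rho> \<alpha> B (st m) (st (Suc m)) \<Longrightarrow> running (st n) \<Longrightarrow>
           subproblems_solvable P W \<rho> \<alpha> B (st n)"
  shows "\<exists>N. (\<forall>n<N. iteration P W \<rho> \<alpha> B (st n) (st (Suc n))) \<and> \<not> running (st N) \<and>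
           ((\<exists>x y. incumbent P (st N) = Some (x, y) \<and> (x, y) \<in> minlp_set P \<and>
                   UB (st N) = ereal (obj P (x, y))) \<or>
            (incumbent P (st N) = None \<and> LB (st N) = \<infinity> \<and> UB (st N) = \<infinity> \<and> minlp_set P = {}))"
proof -
  note solvable = assms(16)
  have init: "initial P (st 0)"
    and step: "\<And>n s'. iteration P W \<rho> \<alpha> B (st n) s' \<Longrightarrow> iteration P W \<rho> \<alpha> B (st n) (st (Suc n))"
    using \<open>execution P W \<rho> \<alpha> B st\<close> by (auto simp: execution_def)
  have reach: "(\<forall>m<n. iteration P W \<rho> \<alpha> B (st m) (st (Suc m))) \<and>
      loop_invariant P (st n) \<and> iter (st n) = n"
    if "\<forall>m<n. running (st m)" for n
    using that
  proof (induction n)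
    case 0
    show ?case using loop_invariant_initial[OF init \<open>relaxation_solvable P\<close>] init
      by (simp add: initial_def)
  next
    case (Suc n)
    hence IH: "\<forall>m<n. iteration P W \<rho> \<alpha> B (st m) (st (Suc m))" "loop_invariant P (st n)"
      "iter (st n) = n" and run: "running (st n)" "running (st 0)" by auto
    \<comment> \<open>An infeasible relaxation gives an infinite initial \<open>LB\<close>, and the
      loop is never entered.\<close>
    have "relaxed_set P \<noteq> {}"
      using run(2) initial_LB[OF init \<open>relaxation_solvable P\<close>] by (auto simp: running_def)
    hence it: "iteration P W \<rho> \<alpha> B (st n) (st (Suc n))"
      using iteration_exists[OF IH(2) run(1) solvable[OF IH(1) run(1)]] step by blast
    show ?case
      using loop_invariant_step[OF IH(2) it \<open>convex (Fbar P)\<close> \<open>pos_def W\<close> \<open>\<alpha> < 1\<close>] IH it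
      by (auto simp: less_Suc_eq)
  qed
  have "\<exists>N. \<not> running (st N)"
  proof (rule ccontr)
    assume "\<nexists>N. \<not> running (st N)"
    hence run: "running (st n)" for n by blast
    \<comment> \<open>After \<open>?n\<close> iterations, \<open>?n + 1\<close> distinct points of
      \<open>Yset P\<close> have been generated, counting the one not yet processed.\<close>
    let ?n = "card (Yset P)"
    have "loop_invariant P (st ?n)" "iter (st ?n) = ?n" using reach run by auto
    hence "inj_on (yseq (st ?n)) {..?n}" "yseq (st ?n) ` {..?n} \<subseteq> Yset P"
      using run by (auto simp: loop_invariant_def)
    from card_inj_on_le[OF this \<open>finite (Yset P)\<close>] show False by simp
  qed
  then obtain N where N: "\<not> running (st N)" "\<forall>n<N. running (st n)"
    using LeastI_ex[of "\<lambda>N. \<not> running (st N)"] not_less_Least by blast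
  show ?thesis using N(1) reach[OF N(2)] loop_invariant_terminated[of P "st N"] by blast
qed

end
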